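(* Consider the free $\mathbb{K}$-algebra $\mathbb{K}\langle\underline x,\underline y\rangle:=\mathbb{K}\langle x_1,\dots,x_n,y_1,\dots,y_m\rangle$ over a field $\mathbb{K}$, an ideal $I\subseteq\mathbb{K}[\underline x]=\mathbb{K}[x_1,\dots,x_n]$ and a commutation system $(S,\prec)$, with $\prec$ a well-ordering, such that $$S=\{[x_j,x_i]\mid 1\le i<j\le n\}\cup\{[y_l,y_k]-d_{kl}\mid 1\le k<l\le m\}\cup\{[y_k,x_i]-f_{ik}\mid 1\le i\le n,1\le k\le m\},$$ where $d_{kl},f_{ik}\in\mathbb{K}[\underline x]$. Suppose that the surjective $\mathbb{K}$-linear homomorphism $$\psi:\bigoplus_{\beta\in\mathbb{N}^m}(\mathbb{K}[\underline x]/I)\,\underline y^\beta\to\mathbb{K}\langle\underline x,\underline y\rangle/\langle I\cup S\rangle,\qquad\overline{\underline x^\alpha}\,\underline y^\beta\mapsto\overline{\underline x^\alpha\underline y^\beta}$$ is injective and that $I'$ is a Gröbner basis of $I\subseteq\mathbb{K}[\underline x]$ with respect to the ordering induced by $\prec$ on the monomials of $\mathbb{K}[\underline x]$. Then $(\mathbb{K}\langle\underline x,\underline y\rangle,S,I',\prec)$ is a PBW-reduction datum.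
   Context: Order the variables as $z_1,\dots,z_{n+m}=x_1,\dots,x_n,y_1,\dots,y_m$ and let $\mathbb{K}\langle\underline z\rangle=\mathbb{K}\langle\underline x,\underline y\rangle$; the commutative polynomial ring $\mathbb{K}[\underline z]=\mathbb{K}[\underline x,\underline y]$ is viewed as the $\mathbb{K}$-subspace of $\mathbb{K}\langle\underline z\rangle$ spanned by the standard monomials $\underline z^\alpha=z_1^{\alpha_1}\cdots z_{n+m}^{\alpha_{n+m}}$. $[a,b]=ab-ba$, and $\langle\cdot\rangle$ denotes the two-sided ideal generated. A monomial ordering on standard monomials is a total order with $\underline z^\alpha\prec\underline z^{\beta}\Rightarrow\underline z^{\alpha+\gamma}\prec\underline z^{\beta+\gamma}$; it is a well-ordering if $1\preceq\underline z^\alpha$ always. For $0\ne p\in\mathbb{K}[\underline z]$, $\operatorname{lm}(p)$ is the leading monomial and $\operatorname{le}(p)$ its exponent. A commutation system $(S,\prec)$ consists of a monomial ordering $\prec$ and a set $S=\{z_jz_i-c_{ij}z_iz_j-d_{ij}\mid i<j\}$ with $c_{ij}\in\mathbb{K}^*$, $d_{ij}\in\mathbb{K}[\underline z]$, $d_{ij}=0$ or $\operatorname{lm}(d_{ij})\prec z_iz_j$, such that every element of $\mathbb{K}\langle\underline z\rangle$ can be transformed into an element of $\mathbb{K}[\underline z]$ by finitely many $\mathbb{K}$-linear reductions, each replacing one monomial $m\,z_jz_i\,m'$ by $m(c_{ij}z_iz_j+d_{ij})m'$. For $G\subseteq\mathbb{K}[\underline z]$ put $\operatorname{l}_\prec(G)=\{\operatorname{le}(g)\mid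 0\neq g\in G\}$ and $\operatorname{L}_\prec(G)=\operatorname{l}_\prec(G)+\mathbb{N}^{n+m}$. A PBW-reduction datum $(\mathbb{K}\langle\underline z\rangle,S,J,\prec)$ is a commutation system $(S,\prec)$ with $\prec$ a well-ordering together with a finite set $J\subseteq\mathbb{K}[\underline z]$ such that $\operatorname{L}_\prec(J)=\operatorname{l}_\prec(\langle J\cup S\rangle\cap\mathbb{K}[\underline z])$. *)

theory Defs
  imports
    "HOL-Library.Poly_Mapping"
    "HOL-Algebra.QuotRing"
    "HOL-Algebra.Product_Groups"
begin

section \<open>Words, free algebras and polynomial rings\<close>

text \<open>
  All algebras live inside an ambient one on countably many variables, numbered from \<open>0\<close>;
  a set \<open>V\<close> of indices selects the variables that are available. The variables
  \<open>z_1, ..., z_N\<close> of the text are those with index in \<open>{..<N}\<close>. With \<open>N = n + m\<close>, the \<open>x\<close>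
  variables are \<open>{..<n}\<close> and the \<open>y\<close> variables are \<open>{n..<n + m}\<close>.

  The free monoid is written additively so that finitely supported functions on it form the free
  algebra under the convolution product of \<^theory>\<open>HOL-Library.Poly_Mapping\<close>.
\<close>

datatype fmonoid = Word (letters: "nat list")

instantiation fmonoid :: monoid_add
begin

definition zero_fmonoid :: fmonoid where
  "0 = Word []"

definition plus_fmonoid :: "fmonoid \<Rightarrow> fmonoid \<Rightarrow> fmonoid" where
  "u + v = Word (letters u @ letters v)"

instance
  by standard (simp_all add: zero_fmonoid_def plus_fmonoid_def)

end

type_synonym expo = "nat \<Rightarrow>\<^sub>0 nat"
type_synonym 'k cpoly = "expo \<Rightarrow>\<^sub>0 'k"
type_synonym 'k ncpoly = "fmonoid \<Rightarrow>\<^sub>0 'k"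

definition exponents :: "nat set \<Rightarrow> expo set" where
  "exponents V = {\<alpha>. Poly_Mapping.keys \<alpha> \<subseteq> V}"

definition words :: "nat set \<Rightarrow> fmonoid set" where
  "words V = {w. set (letters w) \<subseteq> V}"

definition poly_ring :: "nat set \<Rightarrow> ('k::field) cpoly ring" where
  "poly_ring V = \<lparr>carrier = {p. Poly_Mapping.keys p \<subseteq> exponents V}, mult = (*), one = 1, zero = 0, add = (+)\<rparr>"

definition free_alg :: "nat set \<Rightarrow> ('k::field) ncpoly ring" where
  "free_alg V = \<lparr>carrier = {p. Poly_Mapping.keys p \<subseteq> words V}, mult = (*), one = 1, zero = 0, add = (+)\<rparr>"

definition scalar :: "'k::field \<Rightarrow> 'k ncpoly" where
  "scalar c = Poly_Mapping.single 0 c"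

definition mon :: "fmonoid \<Rightarrow> ('k::field) ncpoly" where
  "mon w = Poly_Mapping.single w 1"

definition Z :: "nat \<Rightarrow> ('k::field) ncpoly" where
  "Z i = mon (Word [i])"

definition commutator :: "'k::field ncpoly \<Rightarrow> 'k ncpoly \<Rightarrow> 'k ncpoly" where
  "commutator a b = a * b - b * a"

definition std_word :: "expo \<Rightarrow> fmonoid" where
  "std_word \<alpha> = Word (concat (map (\<lambda>i. replicate (Poly_Mapping.lookup \<alpha> i) i) (sorted_list_of_set (Poly_Mapping.keys \<alpha>))))"

text \<open>
  The linear embedding of the commutative polynomials as the span of the standard monomials. It is
  not multiplicative.
\<close>

definition std :: "'k::field cpoly \<Rightarrow> 'k ncpoly" where
  "std p = (\<Sum>\<alpha>\<in>Poly_Mapping.keys p. Poly_Mapping.single (std_word \<alpha>) (Poly_Mapping.lookup p \<alpha>))"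


section \<open>Monomial orderings and leading exponents\<close>

text \<open>A monomial ordering is given by its strict part, as a relation on exponents.\<close>

definition monomial_ordering :: "nat set \<Rightarrow> (expo \<Rightarrow> expo \<Rightarrow> bool) \<Rightarrow> bool" where
  "monomial_ordering V lt \<longleftrightarrow>
     irreflp_on (exponents V) lt \<and> transp_on (exponents V) lt \<and> totalp_on (exponents V) lt \<and>
     (\<forall>\<alpha>\<in>exponents V. \<forall>\<beta>\<in>exponents V. \<forall>\<gamma>\<in>exponents V. lt \<alpha> \<beta> \<longrightarrow> lt (\<alpha> + \<gamma>) (\<beta> + \<gamma>))"

definition well_ordering :: "nat set \<Rightarrow> (expo \<Rightarrow> expo \<Rightarrow> bool) \<Rightarrow> bool" where
  "well_ordering V lt \<longleftrightarrow> (\<forall>\<alpha>\<in>exponents V. \<alpha> = 0 \<or> lt 0 \<alpha>)"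

definition le :: "(expo \<Rightarrow> expo \<Rightarrow> bool) \<Rightarrow> 'k::field cpoly \<Rightarrow> expo" where
  "le lt p = (THE \<alpha>. \<alpha> \<in> Poly_Mapping.keys p \<and> (\<forall>\<beta>\<in>Poly_Mapping.keys p. \<beta> = \<alpha> \<or> lt \<beta> \<alpha>))"

definition lset :: "(expo \<Rightarrow> expo \<Rightarrow> bool) \<Rightarrow> 'k::field cpoly set \<Rightarrow> expo set" where
  "lset lt G = {le lt g | g. g \<in> G \<and> g \<noteq> 0}"

text \<open>
  \<open>Lset V lt G\<close> is the set of exponents of the monomials in the leading ideal of \<open>G\<close>, i.e. in the
  monomial ideal of \<open>poly_ring V\<close> generated by the leading monomials of \<open>G\<close>.
\<close>

definition Lset :: "nat set \<Rightarrow> (expo \<Rightarrow> expo \<Rightarrow> bool) \<Rightarrow> 'k::field cpoly set \<Rightarrow> expo set" where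
  "Lset V lt G = {\<alpha> + \<gamma> | \<alpha> \<gamma>. \<alpha> \<in> lset lt G \<and> \<gamma> \<in> exponents V}"

definition groebner_basis ::
    "nat set \<Rightarrow> (expo \<Rightarrow> expo \<Rightarrow> bool) \<Rightarrow> 'k::field cpoly set \<Rightarrow> 'k cpoly set \<Rightarrow> bool" where
  "groebner_basis V lt G I \<longleftrightarrow> finite G \<and> G \<subseteq> I \<and> Lset V lt G = Lset V lt I"


section \<open>Commutation systems and PBW-reduction data\<close>

text \<open>
  One reduction applies the linear map that sends the single monomial \<open>u z_j z_i v\<close> to
  \<open>u (c_ij z_i z_j + d_ij) v\<close> and fixes all other monomials.
\<close>

definition reduction_step ::
    "nat \<Rightarrow> (nat \<Rightarrow> nat \<Rightarrow> 'k::field) \<Rightarrow> (nat \<Rightarrow> nat \<Rightarrow> 'k cpoly) \<Rightarrow> 'k ncpoly \<Rightarrow> 'k ncpoly \<Rightarrow> bool"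
where
  "reduction_step N c d p q \<longleftrightarrow>
     (\<exists>u\<in>words {..<N}. \<exists>v\<in>words {..<N}. \<exists>i j. i < j \<and> j < N \<and>
       (let w = u + Word [j, i] + v
        in q = p - scalar (Poly_Mapping.lookup p w) * mon w
               + scalar (Poly_Mapping.lookup p w) *
                 (mon u * (scalar (c i j) * Z i * Z j + std (d i j)) * mon v)))"

definition commutation_system ::
    "nat \<Rightarrow> 'k::field ncpoly set \<Rightarrow> (expo \<Rightarrow> expo \<Rightarrow> bool) \<Rightarrow> bool" where
  "commutation_system N S lt \<longleftrightarrow>
     monomial_ordering {..<N} lt \<and>
     (\<exists>c d.
       (\<forall>i j. i < j \<and> j < N \<longrightarrow>
          c i j \<noteq> 0 \<and> d i j \<in> carrier (poly_ring {..<N}) \<and>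
          (d i j = 0 \<or>
           lt (le lt (d i j)) (Poly_Mapping.single i 1 + Poly_Mapping.single j 1))) \<and>
       S = {Z j * Z i - scalar (c i j) * Z i * Z j - std (d i j) | i j. i < j \<and> j < N} \<and>
       (\<forall>p\<in>carrier (free_alg {..<N}).
          \<exists>q\<in>std ` carrier (poly_ring {..<N}). (reduction_step N c d)\<^sup>*\<^sup>* p q))"

definition PBW_reduction_datum ::
    "nat \<Rightarrow> 'k::field ncpoly set \<Rightarrow> 'k cpoly set \<Rightarrow> (expo \<Rightarrow> expo \<Rightarrow> bool) \<Rightarrow> bool" where
  "PBW_reduction_datum N S J lt \<longleftrightarrow>
     commutation_system N S lt \<and> well_ordering {..<N} lt \<and>
     finite J \<and> J \<subseteq> carrier (poly_ring {..<N}) \<and>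
     Lset {..<N} lt J =
       lset lt {p \<in> carrier (poly_ring {..<N}). std p \<in> genideal (free_alg {..<N}) (std ` J \<union> S)}"


section \<open>The map \<open>\<psi>\<close>\<close>

abbreviation rel_ideal ::
    "nat \<Rightarrow> nat \<Rightarrow> 'k::field cpoly set \<Rightarrow> 'k ncpoly set \<Rightarrow> 'k ncpoly set" where
  "rel_ideal n m I S \<equiv> genideal (free_alg {..<n + m}) (std ` I \<union> S)"

text \<open>
  The direct sum over \<open>\<beta>\<close> of copies of \<open>K[x]/I\<close>: its elements are the finitely supported families
  \<open>F\<close>, where \<open>F \<beta>\<close> is the coefficient of \<open>y\<^sup>\<beta>\<close>. Exponents of \<open>y\<close>-monomials are exponents supported
  on \<open>{n..<n + m}\<close>.
\<close>

definition psi_domain ::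
    "nat \<Rightarrow> nat \<Rightarrow> 'k::field cpoly set \<Rightarrow> (expo \<Rightarrow> 'k cpoly set) monoid" where
  "psi_domain n m I =
     sum_group (exponents {n..<n + m}) (\<lambda>_. add_monoid (poly_ring {..<n} Quot I))"

text \<open>
  \<open>\<psi>\<close> sends the class of \<open>f\<close> in the summand of \<open>\<beta>\<close> to the class of \<open>f y\<^sup>\<beta>\<close>. The latter does not
  depend on the representative \<open>f\<close> (lemma \<open>psi_term_coset\<close> below), so that the image set in
  \<open>psi_term\<close> is a singleton; \<open>psi\<close> is the additive extension to the direct sum. It is the
  linear map of the text by the lemmas \<open>psi_monomial\<close>, \<open>psi_add\<close> and \<open>psi_scale\<close>.
\<close>

definition psi_term ::
    "nat \<Rightarrow> nat \<Rightarrow> 'k::field cpoly set \<Rightarrow> 'k ncpoly set \<Rightarrow> expo \<Rightarrow> 'k cpoly set \<Rightarrow> 'k ncpoly set" where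
  "psi_term n m I S \<beta> C =
     the_elem ((\<lambda>f. rel_ideal n m I S +>\<^bsub>free_alg {..<n + m}\<^esub> (std f * mon (std_word \<beta>))) ` C)"

definition psi ::
    "nat \<Rightarrow> nat \<Rightarrow> 'k::field cpoly set \<Rightarrow> 'k ncpoly set \<Rightarrow> (expo \<Rightarrow> 'k cpoly set) \<Rightarrow> 'k ncpoly set" where
  "psi n m I S F =
     finsum (free_alg {..<n + m} Quot rel_ideal n m I S) (\<lambda>\<beta>. psi_term n m I S \<beta> (F \<beta>))
       {\<beta> \<in> exponents {n..<n + m}. F \<beta> \<noteq> \<zero>\<^bsub>poly_ring {..<n} Quot I\<^esub>}"


text \<open>The map \<open>\<psi>\<close> is well defined and linear, with the prescribed values on monomials.\<close>

lemma ring_free_alg: "ring (free_alg V)"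
proof -
  have c: "p \<in> carrier (free_alg V) \<longleftrightarrow> Poly_Mapping.keys p \<subseteq> words V" for p :: "'a ncpoly"
    by (simp add: free_alg_def)
  have times: "Poly_Mapping.keys (p * q) \<subseteq> words V"
    if "Poly_Mapping.keys p \<subseteq> words V" "Poly_Mapping.keys q \<subseteq> words V" for p q :: "'a ncpoly"
  proof
    fix w assume "w \<in> Poly_Mapping.keys (p * q)"
    then obtain u v where "w = u + v" "u \<in> Poly_Mapping.keys p" "v \<in> Poly_Mapping.keys q"
      using keys_mult[of p q] by blast
    then show "w \<in> words V"
      using that by (auto simp: words_def plus_fmonoid_def)
  qed
  have plus: "Poly_Mapping.keys (p + q) \<subseteq> words V"
    if "Poly_Mapping.keys p \<subseteq> words V" "Poly_Mapping.keys q \<subseteq> words V" for p q :: "'a ncpoly"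
    using that Poly_Mapping.keys_add[of p q] by blast
  have one: "Poly_Mapping.keys (1 :: 'a ncpoly) \<subseteq> words V"
    by (simp add: words_def zero_fmonoid_def)
  show ?thesis
  proof (intro ringI abelian_groupI monoidI)
    fix x assume x: "x \<in> carrier (free_alg V)"
    show "\<exists>y\<in>carrier (free_alg V). y \<oplus>\<^bsub>free_alg V\<^esub> x = \<zero>\<^bsub>free_alg V\<^esub>"
      using x by (intro bexI[of _ "- x"]) (auto simp: free_alg_def)
  qed (use times plus one in \<open>auto simp: free_alg_def algebra_simps\<close>)
qed

lemma cring_poly_ring: "cring (poly_ring V)"
proof -
  have times: "Poly_Mapping.keys (p * q) \<subseteq> exponents V"
    if "Poly_Mapping.keys p \<subseteq> exponents V" "Poly_Mapping.keys q \<subseteq> exponents V"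
    for p q :: "'a cpoly"
  proof
    fix w assume "w \<in> Poly_Mapping.keys (p * q)"
    then obtain u v where "w = u + v" "u \<in> Poly_Mapping.keys p" "v \<in> Poly_Mapping.keys q"
      using keys_mult[of p q] by blast
    then show "w \<in> exponents V"
      using that Poly_Mapping.keys_add[of u v] unfolding exponents_def by blast
  qed
  have plus: "Poly_Mapping.keys (p + q) \<subseteq> exponents V"
    if "Poly_Mapping.keys p \<subseteq> exponents V" "Poly_Mapping.keys q \<subseteq> exponents V"
    for p q :: "'a cpoly"
    using that Poly_Mapping.keys_add[of p q] by blast
  have one: "Poly_Mapping.keys (1 :: 'a cpoly) \<subseteq> exponents V"
    by (simp add: exponents_def)
  show ?thesis
  proof (intro cringI abelian_groupI comm_monoidI)
    fix x assume x: "x \<in> carrier (poly_ring V)"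
    show "\<exists>y\<in>carrier (poly_ring V). y \<oplus>\<^bsub>poly_ring V\<^esub> x = \<zero>\<^bsub>poly_ring V\<^esub>"
      using x by (intro bexI[of _ "- x"]) (auto simp: poly_ring_def)
  qed (use times plus one in \<open>auto simp: poly_ring_def algebra_simps\<close>)
qed

lemma std_superset:
  assumes "finite A" "Poly_Mapping.keys p \<subseteq> A"
  shows "std p = (\<Sum>\<alpha>\<in>A. Poly_Mapping.single (std_word \<alpha>) (Poly_Mapping.lookup p \<alpha>))"
  unfolding std_def
  by (rule sum.mono_neutral_left) (use assms in \<open>auto simp: in_keys_iff\<close>)

lemma std_add: "std (p + q) = std p + std q"
proof -
  let ?A = "Poly_Mapping.keys p \<union> Poly_Mapping.keys q"
  show ?thesis
    using Poly_Mapping.keys_add[of p q]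
    by (simp add: std_superset[of ?A] lookup_add single_add sum.distrib)
qed

lemma lookup_const_times:
  "Poly_Mapping.lookup (Poly_Mapping.single 0 c * p) \<alpha> = c * Poly_Mapping.lookup p \<alpha>"
  for p :: "'a::monoid_add \<Rightarrow>\<^sub>0 'k::field"
proof (cases "c = 0")
  case False
  have "Poly_Mapping.lookup (Poly_Mapping.single 0 c * p) \<alpha> =
        (\<Sum>l. c * (\<Sum>q. Poly_Mapping.lookup p q when \<alpha> = l + q) when l = 0)"
    by (simp add: lookup_mult lookup_single when_mult eq_commute[of 0])
  then show ?thesis
    by simp
qed simp

lemma std_scale: "std (Poly_Mapping.single 0 c * p) = scalar c * std p"
proof -
  have "Poly_Mapping.keys (Poly_Mapping.single 0 c * p) \<subseteq> Poly_Mapping.keys p"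
    by (auto simp: in_keys_iff lookup_const_times)
  then have "std (Poly_Mapping.single 0 c * p) = (\<Sum>\<alpha>\<in>Poly_Mapping.keys p.
      Poly_Mapping.single (std_word \<alpha>) (c * Poly_Mapping.lookup p \<alpha>))"
    by (simp add: std_superset[of "Poly_Mapping.keys p"] lookup_const_times)
  also have "\<dots> = scalar c * std p"
    by (simp add: std_def scalar_def sum_distrib_left mult_single)
  finally show ?thesis .
qed

lemma std_monomial: "std (Poly_Mapping.single \<alpha> 1) = mon (std_word \<alpha>)"
  by (simp add: std_def mon_def)

lemma std_word_closed: "\<alpha> \<in> exponents V \<Longrightarrow> std_word \<alpha> \<in> words V"
  by (auto simp: exponents_def words_def std_word_def)

lemma mon_closed: "w \<in> words V \<Longrightarrow> mon w \<in> carrier (free_alg V)"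
  by (simp add: mon_def free_alg_def)

lemma std_closed:
  assumes "p \<in> carrier (poly_ring V)"
  shows "std p \<in> carrier (free_alg V)"
proof -
  have "Poly_Mapping.keys (std p) \<subseteq>
      (\<Union>\<alpha>\<in>Poly_Mapping.keys p. Poly_Mapping.keys (Poly_Mapping.single (std_word \<alpha>) (Poly_Mapping.lookup p \<alpha>)))"
    unfolding std_def by (rule keys_sum)
  also have "\<dots> \<subseteq> words V"
    using assms by (auto simp: poly_ring_def std_word_closed)
  finally show ?thesis
    by (simp add: free_alg_def)
qed

lemma poly_ring_mono: "V \<subseteq> W \<Longrightarrow> carrier (poly_ring V) \<subseteq> carrier (poly_ring W)"
  by (auto simp: poly_ring_def exponents_def)

lemma add_free_alg: "x \<oplus>\<^bsub>free_alg V\<^esub> y = x + y"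
  and mult_free_alg: "x \<otimes>\<^bsub>free_alg V\<^esub> y = x * y"
  by (simp_all add: free_alg_def)

lemma coset_in_quot:
  assumes "ideal I R" "f \<in> carrier R"
  shows "I +>\<^bsub>R\<^esub> f \<in> carrier (R Quot I)"
proof -
  interpret ideal I R by (rule assms(1))
  show ?thesis
    using a_rcosetsI[OF a_subset assms(2)] by (simp add: FactRing_def)
qed

context
  fixes n m :: nat and I :: "'k::field cpoly set" and S :: "'k ncpoly set"
  assumes I: "ideal I (poly_ring {..<n})"
    and S: "S \<subseteq> carrier (free_alg {..<n + m})"
begin

lemma rel_ideal_ideal: "ideal (rel_ideal n m I S) (free_alg {..<n + m})"
proof (rule ring.genideal_ideal[OF ring_free_alg])
  have "I \<subseteq> carrier (poly_ring {..<n + m})"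
    using I poly_ring_mono[of "{..<n}" "{..<n + m}"]
    by (auto dest!: ideal.axioms(1) additive_subgroup.a_subset)
  then show "std ` I \<union> S \<subseteq> carrier (free_alg {..<n + m})"
    using S std_closed by blast
qed

lemma ring_quot: "ring (free_alg {..<n + m} Quot rel_ideal n m I S)"
  using rel_ideal_ideal by (rule ideal.quotient_is_ring)

lemma psi_term_coset:
  assumes f: "f \<in> carrier (poly_ring {..<n})" and \<beta>: "\<beta> \<in> exponents {n..<n + m}"
  shows "psi_term n m I S \<beta> (I +>\<^bsub>poly_ring {..<n}\<^esub> f) =
         rel_ideal n m I S +>\<^bsub>free_alg {..<n + m}\<^esub> (std f * mon (std_word \<beta>))"
proof -
  let ?A = "free_alg {..<n + m} :: 'k ncpoly ring" and ?P = "poly_ring {..<n} :: 'k cpoly ring"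
  interpret A: ring ?A by (rule ring_free_alg)
  interpret P: ideal I ?P by (rule I)
  interpret J: ideal "rel_ideal n m I S" ?A by (rule rel_ideal_ideal)
  have mon: "mon (std_word \<beta>) \<in> carrier ?A"
  proof (intro mon_closed std_word_closed)
    show "\<beta> \<in> exponents {..<n + m}"
      using \<beta> by (auto simp: exponents_def)
  qed
  have std: "std g \<in> carrier ?A" if "g \<in> carrier ?P" for g
    using that poly_ring_mono[of "{..<n}" "{..<n + m}"] by (intro std_closed) auto
  have eq: "rel_ideal n m I S +>\<^bsub>?A\<^esub> (std g * mon (std_word \<beta>)) =
            rel_ideal n m I S +>\<^bsub>?A\<^esub> (std f * mon (std_word \<beta>))"
    if "g \<in> I +>\<^bsub>?P\<^esub> f" for g
  proof -
    from that obtain h where h: "h \<in> I" "g = h + f"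
      by (auto simp: a_r_coset_def r_coset_def poly_ring_def)
    have hP: "h \<in> carrier ?P"
      using h(1) P.a_subset by blast
    have subs: "std ` I \<union> S \<subseteq> rel_ideal n m I S"
      unfolding genideal_def by blast
    then have "std h \<in> rel_ideal n m I S"
      using h(1) by blast
    then have "std h \<otimes>\<^bsub>?A\<^esub> mon (std_word \<beta>) \<in> rel_ideal n m I S"
      using mon by (rule J.I_r_closed)
    moreover have "std g * mon (std_word \<beta>) =
        (std h \<otimes>\<^bsub>?A\<^esub> mon (std_word \<beta>)) \<oplus>\<^bsub>?A\<^esub> (std f * mon (std_word \<beta>))"
      by (simp add: h(2) std_add distrib_right free_alg_def)
    ultimately have "std g * mon (std_word \<beta>) \<in>
        rel_ideal n m I S +>\<^bsub>?A\<^esub> (std f * mon (std_word \<beta>))"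
      by (auto simp: a_r_coset_def r_coset_def)
    moreover have "std f * mon (std_word \<beta>) \<in> carrier ?A"
      using A.m_closed[OF std[OF f] mon] by (simp add: free_alg_def)
    ultimately show ?thesis
      by (rule A.a_repr_independence[OF _ _ J.a_subgroup, symmetric])
  qed
  have "f \<in> I +>\<^bsub>?P\<^esub> f"
    by (rule P.a_rcos_self[OF f])
  then have "(\<lambda>g. rel_ideal n m I S +>\<^bsub>?A\<^esub> (std g * mon (std_word \<beta>))) ` (I +>\<^bsub>?P\<^esub> f) =
      {rel_ideal n m I S +>\<^bsub>?A\<^esub> (std f * mon (std_word \<beta>))}"
    using eq by blast
  then show ?thesis
    by (simp add: psi_term_def)
qed

lemma quot_cases:
  assumes "C \<in> carrier (poly_ring {..<n} Quot I)"
  obtains f where "f \<in> carrier (poly_ring {..<n})" "C = I +>\<^bsub>poly_ring {..<n}\<^esub> f"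
proof -
  have "carrier (poly_ring {..<n} Quot I) = {I +>\<^bsub>poly_ring {..<n}\<^esub> f | f. f \<in> carrier (poly_ring {..<n})}"
    by (auto simp: FactRing_def A_RCOSETS_defs a_r_coset_def)
  then show ?thesis
    using assms that by blast
qed

lemma zero_in_poly_ring: "0 \<in> carrier (poly_ring V)"
  by (simp add: poly_ring_def)

lemma zero_coset: "\<zero>\<^bsub>poly_ring {..<n} Quot I\<^esub> = I +>\<^bsub>poly_ring {..<n}\<^esub> 0"
  by (simp add: FactRing_def a_r_coset_def r_coset_def poly_ring_def)

lemma prod_mon_closed:
  fixes f :: "'k cpoly"
  assumes "f \<in> carrier (poly_ring {..<n})" and "\<beta> \<in> exponents {n..<n + m}"
  shows "std f * mon (std_word \<beta>) \<in> carrier (free_alg {..<n + m})"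
proof -
  interpret A: ring "free_alg {..<n + m} :: 'k ncpoly ring" by (rule ring_free_alg)
  have "mon (std_word \<beta>) \<in> carrier (free_alg {..<n + m})"
    using assms(2) by (intro mon_closed std_word_closed) (auto simp: exponents_def)
  moreover have "std f \<in> carrier (free_alg {..<n + m})"
    using assms(1) poly_ring_mono[of "{..<n}" "{..<n + m}"] by (intro std_closed) auto
  ultimately show ?thesis
    using A.m_closed[of "std f" "mon (std_word \<beta>)"] by (simp add: free_alg_def)
qed

lemma psi_term_closed:
  assumes "C \<in> carrier (poly_ring {..<n} Quot I)" and "\<beta> \<in> exponents {n..<n + m}"
  shows "psi_term n m I S \<beta> C \<in> carrier (free_alg {..<n + m} Quot rel_ideal n m I S)"
proof -
  from assms(1) obtain f where "f \<in> carrier (poly_ring {..<n})" "C = I +>\<^bsub>poly_ring {..<n}\<^esub> f"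
    by (rule quot_cases)
  then show ?thesis
    by (simp add: prod_mon_closed[OF _ assms(2)] psi_term_coset[OF _ assms(2)]
        coset_in_quot[OF rel_ideal_ideal])
qed

lemma psi_term_zero:
  assumes "\<beta> \<in> exponents {n..<n + m}"
  shows "psi_term n m I S \<beta> \<zero>\<^bsub>poly_ring {..<n} Quot I\<^esub> =
         \<zero>\<^bsub>free_alg {..<n + m} Quot rel_ideal n m I S\<^esub>"
  unfolding zero_coset
  by (subst psi_term_coset[OF zero_in_poly_ring assms])
    (simp add: std_def FactRing_def a_r_coset_def r_coset_def free_alg_def)

lemma psi_term_add:
  assumes C: "C \<in> carrier (poly_ring {..<n} Quot I)" and D: "D \<in> carrier (poly_ring {..<n} Quot I)"
    and \<beta>: "\<beta> \<in> exponents {n..<n + m}"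
  shows "psi_term n m I S \<beta> (C \<oplus>\<^bsub>poly_ring {..<n} Quot I\<^esub> D) =
         psi_term n m I S \<beta> C \<oplus>\<^bsub>free_alg {..<n + m} Quot rel_ideal n m I S\<^esub> psi_term n m I S \<beta> D"
proof -
  interpret P: ideal I "poly_ring {..<n} :: 'k cpoly ring" by (rule I)
  interpret J: ideal "rel_ideal n m I S" "free_alg {..<n + m} :: 'k ncpoly ring"
    by (rule rel_ideal_ideal)
  obtain f where f: "f \<in> carrier (poly_ring {..<n})" "C = I +>\<^bsub>poly_ring {..<n}\<^esub> f"
    using C by (rule quot_cases)
  obtain g where g: "g \<in> carrier (poly_ring {..<n})" "D = I +>\<^bsub>poly_ring {..<n}\<^esub> g"
    using D by (rule quot_cases)
  have plus: "f \<oplus>\<^bsub>poly_ring {..<n}\<^esub> g = f + g"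
    by (simp add: poly_ring_def)
  have CD: "C \<oplus>\<^bsub>poly_ring {..<n} Quot I\<^esub> D = I +>\<^bsub>poly_ring {..<n}\<^esub> (f + g)"
    using P.a_rcos_sum[OF f(1) g(1)] by (simp add: f g FactRing_def plus)
  have fg: "f + g \<in> carrier (poly_ring {..<n})"
    using P.a_closed[OF f(1) g(1)] by (simp add: plus)
  show ?thesis
    unfolding CD
    unfolding psi_term_coset[OF fg \<beta>] f(2) g(2) psi_term_coset[OF f(1) \<beta>] psi_term_coset[OF g(1) \<beta>]
    using J.a_rcos_sum[OF prod_mon_closed[OF f(1) \<beta>] prod_mon_closed[OF g(1) \<beta>]]
    by (simp add: FactRing_def std_add distrib_right add_free_alg)
qed

lemma psi_term_scale:
  assumes C: "C \<in> carrier (poly_ring {..<n} Quot I)" and \<beta>: "\<beta> \<in> exponents {n..<n + m}"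
  shows "psi_term n m I S \<beta>
           ((I +>\<^bsub>poly_ring {..<n}\<^esub> Poly_Mapping.single 0 c) \<otimes>\<^bsub>poly_ring {..<n} Quot I\<^esub> C) =
         (rel_ideal n m I S +>\<^bsub>free_alg {..<n + m}\<^esub> scalar c)
           \<otimes>\<^bsub>free_alg {..<n + m} Quot rel_ideal n m I S\<^esub> psi_term n m I S \<beta> C"
proof -
  interpret P: ideal I "poly_ring {..<n} :: 'k cpoly ring" by (rule I)
  interpret J: ideal "rel_ideal n m I S" "free_alg {..<n + m} :: 'k ncpoly ring"
    by (rule rel_ideal_ideal)
  obtain f where f: "f \<in> carrier (poly_ring {..<n})" "C = I +>\<^bsub>poly_ring {..<n}\<^esub> f"
    using C by (rule quot_cases)
  have c: "Poly_Mapping.single 0 c \<in> carrier (poly_ring {..<n} :: 'k cpoly ring)"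
    by (simp add: poly_ring_def exponents_def)
  have c': "scalar c \<in> carrier (free_alg {..<n + m} :: 'k ncpoly ring)"
    by (simp add: free_alg_def words_def scalar_def zero_fmonoid_def)
  have times: "Poly_Mapping.single 0 c \<otimes>\<^bsub>poly_ring {..<n}\<^esub> f = Poly_Mapping.single 0 c * f"
    by (simp add: poly_ring_def)
  have cf: "Poly_Mapping.single 0 c * f \<in> carrier (poly_ring {..<n})"
    using P.m_closed[OF c f(1)] by (simp add: times)
  have cC: "(I +>\<^bsub>poly_ring {..<n}\<^esub> Poly_Mapping.single 0 c) \<otimes>\<^bsub>poly_ring {..<n} Quot I\<^esub> C =
      I +>\<^bsub>poly_ring {..<n}\<^esub> (Poly_Mapping.single 0 c * f)"
    using P.rcoset_mult_add[OF c f(1)] by (simp add: f FactRing_def times)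
  show ?thesis
    unfolding cC
    unfolding psi_term_coset[OF cf \<beta>] f(2) psi_term_coset[OF f(1) \<beta>]
    using J.rcoset_mult_add[OF c' prod_mon_closed[OF f(1) \<beta>]]
    by (simp add: FactRing_def std_scale mult.assoc mult_free_alg)
qed

lemma psi_domain_carrier:
  "carrier (psi_domain n m I) =
     {F \<in> exponents {n..<n + m} \<rightarrow>\<^sub>E carrier (poly_ring {..<n} Quot I).
        finite {\<beta> \<in> exponents {n..<n + m}. F \<beta> \<noteq> \<zero>\<^bsub>poly_ring {..<n} Quot I\<^esub>}}"
proof -
  have "group (add_monoid (poly_ring {..<n} Quot I))"
    by (rule abelian_group.a_group[OF ring.is_abelian_group[OF ideal.quotient_is_ring[OF I]]])
  then show ?thesis
    by (simp add: psi_domain_def carrier_sum_group)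
qed

lemma psi_superset:
  assumes F: "F \<in> carrier (psi_domain n m I)" and B: "finite B" "B \<subseteq> exponents {n..<n + m}"
    and supp: "\<And>\<beta>. \<beta> \<in> exponents {n..<n + m} - B \<Longrightarrow> F \<beta> = \<zero>\<^bsub>poly_ring {..<n} Quot I\<^esub>"
  shows "psi n m I S F =
    finsum (free_alg {..<n + m} Quot rel_ideal n m I S) (\<lambda>\<beta>. psi_term n m I S \<beta> (F \<beta>)) B"
proof -
  interpret Q: ring "free_alg {..<n + m} Quot rel_ideal n m I S" by (rule ring_quot)
  show ?thesis
    unfolding psi_def
  proof (rule Q.add.finprod_mono_neutral_cong_left)
    show "psi_term n m I S \<beta> (F \<beta>) = \<zero>\<^bsub>free_alg {..<n + m} Quot rel_ideal n m I S\<^esub>"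
      if "\<beta> \<in> B - {\<beta> \<in> exponents {n..<n + m}. F \<beta> \<noteq> \<zero>\<^bsub>poly_ring {..<n} Quot I\<^esub>}" for \<beta>
      using that B(2) psi_term_zero[of \<beta>] by auto
    show "(\<lambda>\<beta>. psi_term n m I S \<beta> (F \<beta>)) \<in> B \<rightarrow> carrier (free_alg {..<n + m} Quot rel_ideal n m I S)"
      using F B(2) by (auto simp: psi_domain_carrier intro!: psi_term_closed)
  qed (use B supp in auto)
qed

lemma psi_monomial:
  assumes \<alpha>: "\<alpha> \<in> exponents {..<n}" and \<beta>: "\<beta> \<in> exponents {n..<n + m}"
  shows "psi n m I S (\<lambda>\<gamma>\<in>exponents {n..<n + m}.
           if \<gamma> = \<beta> then I +>\<^bsub>poly_ring {..<n}\<^esub> Poly_Mapping.single \<alpha> 1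
           else \<zero>\<^bsub>poly_ring {..<n} Quot I\<^esub>) =
         rel_ideal n m I S +>\<^bsub>free_alg {..<n + m}\<^esub> (mon (std_word \<alpha>) * mon (std_word \<beta>))"
    (is "psi n m I S ?F = _")
proof -
  interpret Q: ring "free_alg {..<n + m} Quot rel_ideal n m I S" by (rule ring_quot)
  interpret QP: ring "poly_ring {..<n} Quot I" by (rule ideal.quotient_is_ring[OF I])
  have x: "Poly_Mapping.single \<alpha> 1 \<in> carrier (poly_ring {..<n} :: 'k cpoly ring)"
    using \<alpha> by (simp add: poly_ring_def)
  then have "I +>\<^bsub>poly_ring {..<n}\<^esub> Poly_Mapping.single \<alpha> 1 \<in> carrier (poly_ring {..<n} Quot I)"
    by (rule coset_in_quot[OF I])
  moreover have "finite {\<gamma> \<in> exponents {n..<n + m}. ?F \<gamma> \<noteq> \<zero>\<^bsub>poly_ring {..<n} Quot I\<^esub>}"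
    by (rule finite_subset[of _ "{\<beta>}"]) auto
  ultimately have Fcar: "?F \<in> carrier (psi_domain n m I)"
    by (auto simp: psi_domain_carrier)
  then have "psi n m I S ?F =
      finsum (free_alg {..<n + m} Quot rel_ideal n m I S) (\<lambda>\<beta>. psi_term n m I S \<beta> (?F \<beta>)) {\<beta>}"
    using \<beta> by (intro psi_superset) auto
  also have "\<dots> = psi_term n m I S \<beta> (?F \<beta>)"
  proof -
    have "psi_term n m I S \<beta> (?F \<beta>) \<in> carrier (free_alg {..<n + m} Quot rel_ideal n m I S)"
      using Fcar \<beta> by (intro psi_term_closed) (unfold psi_domain_carrier, blast+)
    then show ?thesis
      by (simp add: Q.finsum_insert del: restrict_apply)
  qed
  finally show ?thesis
    using psi_term_coset[OF x \<beta>] \<beta> by (simp add: std_monomial)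
qed

lemma psi_add:
  assumes F: "F \<in> carrier (psi_domain n m I)" and G: "G \<in> carrier (psi_domain n m I)"
  shows "psi n m I S (F \<otimes>\<^bsub>psi_domain n m I\<^esub> G) =
         psi n m I S F \<oplus>\<^bsub>free_alg {..<n + m} Quot rel_ideal n m I S\<^esub> psi n m I S G"
proof -
  let ?Y = "exponents {n..<n + m}" and ?P = "poly_ring {..<n} Quot I"
  let ?Q = "free_alg {..<n + m} Quot rel_ideal n m I S"
  let ?H = "F \<otimes>\<^bsub>psi_domain n m I\<^esub> G"
  interpret Q: ring ?Q by (rule ring_quot)
  interpret P: ring ?P by (rule ideal.quotient_is_ring[OF I])
  define B where "B = {\<beta> \<in> ?Y. F \<beta> \<noteq> \<zero>\<^bsub>?P\<^esub>} \<union> {\<beta> \<in> ?Y. G \<beta> \<noteq> \<zero>\<^bsub>?P\<^esub>}"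
  have B: "finite B" "B \<subseteq> ?Y"
    using F G by (auto simp: psi_domain_carrier B_def)
  have mem: "F \<beta> \<in> carrier ?P" "G \<beta> \<in> carrier ?P" if "\<beta> \<in> ?Y" for \<beta>
    using F G that by (auto simp: psi_domain_carrier)
  have Happ: "?H \<beta> = F \<beta> \<oplus>\<^bsub>?P\<^esub> G \<beta>" if "\<beta> \<in> ?Y" for \<beta>
    using that by (simp add: psi_domain_def)
  have "group (psi_domain n m I)"
    unfolding psi_domain_def by (intro sum_group P.a_group)
  then have H: "?H \<in> carrier (psi_domain n m I)"
    using F G by (simp add: group.is_monoid monoid.m_closed)
  have "psi n m I S ?H = finsum ?Q (\<lambda>\<beta>. psi_term n m I S \<beta> (?H \<beta>)) B"
    using H B by (rule psi_superset) (simp add: Happ B_def)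
  also have "\<dots> = finsum ?Q (\<lambda>\<beta>. psi_term n m I S \<beta> (F \<beta>) \<oplus>\<^bsub>?Q\<^esub> psi_term n m I S \<beta> (G \<beta>)) B"
    using B(2) mem by (intro Q.finsum_cong') (auto simp: Happ psi_term_add psi_term_closed subset_iff)
  also have "\<dots> = finsum ?Q (\<lambda>\<beta>. psi_term n m I S \<beta> (F \<beta>)) B
      \<oplus>\<^bsub>?Q\<^esub> finsum ?Q (\<lambda>\<beta>. psi_term n m I S \<beta> (G \<beta>)) B"
    using B(2) mem by (intro Q.finsum_addf) (auto simp: psi_term_closed subset_iff)
  also have "finsum ?Q (\<lambda>\<beta>. psi_term n m I S \<beta> (F \<beta>)) B = psi n m I S F"
    using F B by (intro psi_superset[symmetric]) (auto simp: B_def)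
  also have "finsum ?Q (\<lambda>\<beta>. psi_term n m I S \<beta> (G \<beta>)) B = psi n m I S G"
    using G B by (intro psi_superset[symmetric]) (auto simp: B_def)
  finally show ?thesis .
qed

lemma psi_scale:
  assumes F: "F \<in> carrier (psi_domain n m I)"
  shows "psi n m I S (\<lambda>\<beta>\<in>exponents {n..<n + m}.
           (I +>\<^bsub>poly_ring {..<n}\<^esub> Poly_Mapping.single 0 c) \<otimes>\<^bsub>poly_ring {..<n} Quot I\<^esub> F \<beta>) =
         (rel_ideal n m I S +>\<^bsub>free_alg {..<n + m}\<^esub> scalar c)
           \<otimes>\<^bsub>free_alg {..<n + m} Quot rel_ideal n m I S\<^esub> psi n m I S F"
    (is "psi n m I S ?H = ?c' \<otimes>\<^bsub>_\<^esub> _")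
proof -
  let ?Y = "exponents {n..<n + m}" and ?P = "poly_ring {..<n} Quot I"
  let ?Q = "free_alg {..<n + m} Quot rel_ideal n m I S"
  interpret Q: ring ?Q by (rule ring_quot)
  interpret P: ring ?P by (rule ideal.quotient_is_ring[OF I])
  define B where "B = {\<beta> \<in> ?Y. F \<beta> \<noteq> \<zero>\<^bsub>?P\<^esub>}"
  have B: "finite B" "B \<subseteq> ?Y"
    using F by (auto simp: psi_domain_carrier B_def)
  have mem: "F \<beta> \<in> carrier ?P" if "\<beta> \<in> ?Y" for \<beta>
    using F that by (auto simp: psi_domain_carrier)
  have "Poly_Mapping.single 0 c \<in> carrier (poly_ring {..<n} :: 'k cpoly ring)"
    by (simp add: poly_ring_def exponents_def)
  then have c: "I +>\<^bsub>poly_ring {..<n}\<^esub> Poly_Mapping.single 0 c \<in> carrier ?P"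
    by (rule coset_in_quot[OF I])
  have "scalar c \<in> carrier (free_alg {..<n + m} :: 'k ncpoly ring)"
    by (simp add: free_alg_def words_def scalar_def zero_fmonoid_def)
  then have c': "?c' \<in> carrier ?Q"
    by (rule coset_in_quot[OF rel_ideal_ideal])
  have "{\<beta> \<in> ?Y. ?H \<beta> \<noteq> \<zero>\<^bsub>?P\<^esub>} \<subseteq> B"
    using c by (auto simp: B_def)
  then have "finite {\<beta> \<in> ?Y. ?H \<beta> \<noteq> \<zero>\<^bsub>?P\<^esub>}"
    using B(1) finite_subset by blast
  then have H: "?H \<in> carrier (psi_domain n m I)"
    using c mem by (simp add: psi_domain_carrier)
  have "psi n m I S ?H = finsum ?Q (\<lambda>\<beta>. psi_term n m I S \<beta> (?H \<beta>)) B"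
    using H B by (rule psi_superset) (use c in \<open>simp add: B_def\<close>)
  also have "\<dots> = finsum ?Q (\<lambda>\<beta>. ?c' \<otimes>\<^bsub>?Q\<^esub> psi_term n m I S \<beta> (F \<beta>)) B"
    using B(2) mem c' by (intro Q.finsum_cong') (auto simp: psi_term_scale psi_term_closed subset_iff)
  also have "\<dots> = ?c' \<otimes>\<^bsub>?Q\<^esub> finsum ?Q (\<lambda>\<beta>. psi_term n m I S \<beta> (F \<beta>)) B"
    using B mem c' by (intro Q.finsum_rdistr[symmetric]) (auto simp: psi_term_closed subset_iff)
  also have "finsum ?Q (\<lambda>\<beta>. psi_term n m I S \<beta> (F \<beta>)) B = psi n m I S F"
    using F B by (intro psi_superset[symmetric]) (auto simp: B_def)
  finally show ?thesis .
qed

end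

end

theory Submission
  imports Defs "HOL-Library.Multiset"
begin

text \<open>
  The assertion is an equality between the monomials divisible by a leading monomial of \<open>I'\<close> and
  the leading monomials of the polynomials \<open>p\<close> whose standard form lies in
  \<open>J = \<langle>I' \<union> S\<rangle>\<close>. Each inclusion has its own reason.

  From left to right, let \<open>g \<in> I'\<close>, and let \<open>x\<^sup>\<alpha> y\<^sup>\<beta>\<close> be any monomial. The commutative product
  \<open>g x\<^sup>\<alpha> y\<^sup>\<beta>\<close> has the required leading monomial (\<open>le_times_monomial\<close>). Its standard form differs
  from the product \<open>g \<cdot> x\<^sup>\<alpha> y\<^sup>\<beta>\<close> in the free algebra, which lies in \<open>J\<close>, only in the order of the
  \<open>x\<close> letters inside each word. The commutators of the \<open>x\<close> variables belong to \<open>S\<close>, so this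
  order does not matter modulo \<open>J\<close> (\<open>permuted_words_congruent\<close>). Hence the standard form
  lies in \<open>J\<close> (\<open>std_times_monomial_in_ideal\<close>).

  From right to left, sort \<open>p\<close> by powers of \<open>y\<close>, as \<open>p = \<Sum> p\<^sub>\<beta> y\<^sup>\<beta>\<close> with \<open>p\<^sub>\<beta>\<close> in the \<open>x\<close> variables
  only. In a standard monomial the \<open>x\<close> letters precede the \<open>y\<close> letters, so \<open>std\<close> respects this
  expansion (\<open>std_expand_slices\<close>), and the class of \<open>std p\<close> modulo \<open>\<langle>I \<union> S\<rangle>\<close> is the image under
  \<open>\<psi>\<close> of the family of the classes of the \<open>p\<^sub>\<beta>\<close>. Since \<open>J \<subseteq> \<langle>I \<union> S\<rangle>\<close>, this class is zero, and
  injectivity of \<open>\<psi>\<close> puts every \<open>p\<^sub>\<beta>\<close> into \<open>I\<close> (\<open>slice_in_ideal_if_inj_psi\<close>). The leading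
  monomial of \<open>p\<close> is \<open>y\<^sup>\<beta>\<close> times that of one \<open>p\<^sub>\<beta>\<close> (\<open>le_slice\<close>), and the latter is divisible by
  a leading monomial of the Groebner basis \<open>I'\<close>.
\<close>

section \<open>Leading exponents\<close>

lemma monomial_orderingD:
  assumes "monomial_ordering V lt"
  shows "irreflp_on (exponents V) lt" "transp_on (exponents V) lt" "totalp_on (exponents V) lt"
    and "\<lbrakk>\<alpha> \<in> exponents V; \<beta> \<in> exponents V; \<gamma> \<in> exponents V; lt \<alpha> \<beta>\<rbrakk> \<Longrightarrow> lt (\<alpha> + \<gamma>) (\<beta> + \<gamma>)"
  using assms by (auto simp: monomial_ordering_def)

lemma le_eqI:
  assumes ord: "monomial_ordering V lt" and p: "Poly_Mapping.keys p \<subseteq> exponents V"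
    and \<alpha>: "\<alpha> \<in> Poly_Mapping.keys p"
    and max: "\<And>\<beta>. \<beta> \<in> Poly_Mapping.keys p \<Longrightarrow> \<beta> = \<alpha> \<or> lt \<beta> \<alpha>"
  shows "le lt p = \<alpha>"
  unfolding le_def
proof (rule the_equality)
  fix \<gamma> assume \<gamma>: "\<gamma> \<in> Poly_Mapping.keys p \<and> (\<forall>\<beta>\<in>Poly_Mapping.keys p. \<beta> = \<gamma> \<or> lt \<beta> \<gamma>)"
  show "\<gamma> = \<alpha>"
  proof (rule ccontr)
    assume "\<gamma> \<noteq> \<alpha>"
    with \<gamma> \<alpha> max[of \<gamma>] have "lt \<alpha> \<gamma>" "lt \<gamma> \<alpha>"
      by auto
    then have "lt \<alpha> \<alpha>"
      using monomial_orderingD(2)[OF ord] p \<alpha> \<gamma> by (meson subsetD transp_onD)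
    then show False
      using monomial_orderingD(1)[OF ord] p \<alpha> by (meson irreflp_onD subsetD)
  qed
qed (use \<alpha> max in blast)

lemma le_max:
  assumes ord: "monomial_ordering V lt" and p: "Poly_Mapping.keys p \<subseteq> exponents V" and "p \<noteq> 0"
  shows "le lt p \<in> Poly_Mapping.keys p"
    and "\<beta> \<in> Poly_Mapping.keys p \<Longrightarrow> \<beta> = le lt p \<or> lt \<beta> (le lt p)"
proof -
  let ?A = "Poly_Mapping.keys p"
  have trans: "transp_on ?A lt" and irr: "irreflp_on ?A lt" and tot: "totalp_on ?A lt"
    using monomial_orderingD[OF ord] p
    by (blast intro: transp_on_subset irreflp_on_subset totalp_on_subset)+
  have "asymp_on ?A lt"
    using trans irr by (simp add: asymp_on_iff_irreflp_on_if_transp_on)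
  then obtain \<mu> where \<mu>: "\<mu> \<in> ?A" "\<And>x. x \<in> ?A \<Longrightarrow> x \<noteq> \<mu> \<Longrightarrow> \<not> lt \<mu> x"
    using Finite_Set.bex_max_element[of ?A lt] trans \<open>p \<noteq> 0\<close> by auto
  then have max: "x = \<mu> \<or> lt x \<mu>" if "x \<in> ?A" for x
    using that tot by (metis totalp_onD)
  moreover have "le lt p = \<mu>"
    using le_eqI[OF ord p \<mu>(1) max] .
  ultimately show "le lt p \<in> ?A" "\<beta> \<in> ?A \<Longrightarrow> \<beta> = le lt p \<or> lt \<beta> (le lt p)"
    using \<mu>(1) by auto
qed

lemma exponents_add: "\<alpha> \<in> exponents V \<Longrightarrow> \<beta> \<in> exponents V \<Longrightarrow> \<alpha> + \<beta> \<in> exponents V"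
  unfolding exponents_def using Poly_Mapping.keys_add[of \<alpha> \<beta>] by blast

lemma exponents_mono: "V \<subseteq> W \<Longrightarrow> exponents V \<subseteq> exponents W"
  by (auto simp: exponents_def)

lemma poly_mapping_expand:
  "p = (\<Sum>\<alpha>\<in>Poly_Mapping.keys p. Poly_Mapping.single \<alpha> (Poly_Mapping.lookup p \<alpha>))"
  by (rule poly_mapping_eqI) (auto simp: lookup_sum lookup_single when_def in_keys_iff)

lemma times_monomial:
  "p * Poly_Mapping.single \<gamma> 1 =
     (\<Sum>\<alpha>\<in>Poly_Mapping.keys p. Poly_Mapping.single (\<alpha> + \<gamma>) (Poly_Mapping.lookup p \<alpha>))"
  for p :: "'k::field cpoly"
  by (subst (1) poly_mapping_expand) (simp add: sum_distrib_right mult_single)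

lemma lookup_times_monomial:
  "Poly_Mapping.lookup (p * Poly_Mapping.single \<gamma> 1) (\<alpha> + \<gamma>) = Poly_Mapping.lookup p \<alpha>"
  for p :: "'k::field cpoly"
  by (auto simp: times_monomial lookup_sum lookup_single when_def in_keys_iff)

lemma keys_times_monomial:
  "Poly_Mapping.keys (p * Poly_Mapping.single \<gamma> 1) = (\<lambda>\<alpha>. \<alpha> + \<gamma>) ` Poly_Mapping.keys p"
  for p :: "'k::field cpoly"
proof
  show "Poly_Mapping.keys (p * Poly_Mapping.single \<gamma> 1) \<subseteq> (\<lambda>\<alpha>. \<alpha> + \<gamma>) ` Poly_Mapping.keys p"
    using keys_mult[of p "Poly_Mapping.single \<gamma> 1"] by (auto split: if_splits)
  show "(\<lambda>\<alpha>. \<alpha> + \<gamma>) ` Poly_Mapping.keys p \<subseteq> Poly_Mapping.keys (p * Poly_Mapping.single \<gamma> 1)"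
    by (auto simp: in_keys_iff lookup_times_monomial)
qed

lemma le_times_monomial:
  fixes p :: "'k::field cpoly"
  assumes ord: "monomial_ordering V lt" and p: "Poly_Mapping.keys p \<subseteq> exponents V" and "p \<noteq> 0"
    and \<gamma>: "\<gamma> \<in> exponents V"
  shows "le lt (p * Poly_Mapping.single \<gamma> 1) = le lt p + \<gamma>"
proof (rule le_eqI[OF ord])
  show "Poly_Mapping.keys (p * Poly_Mapping.single \<gamma> 1) \<subseteq> exponents V"
    using p \<gamma> by (auto simp: keys_times_monomial intro: exponents_add)
  show "le lt p + \<gamma> \<in> Poly_Mapping.keys (p * Poly_Mapping.single \<gamma> 1)"
    using le_max(1)[OF ord p \<open>p \<noteq> 0\<close>] by (simp add: keys_times_monomial)
  show "\<beta> = le lt p + \<gamma> \<or> lt \<beta> (le lt p + \<gamma>)"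
    if "\<beta> \<in> Poly_Mapping.keys (p * Poly_Mapping.single \<gamma> 1)" for \<beta>
    using that le_max[OF ord p \<open>p \<noteq> 0\<close>] monomial_orderingD(4)[OF ord _ _ \<gamma>] p
    unfolding keys_times_monomial by blast
qed

section \<open>Standard words\<close>

lemma count_list_std_word:
  "count_list (letters (std_word \<alpha>)) i = Poly_Mapping.lookup \<alpha> i"
proof -
  have rep: "count_list (replicate k j) i = (if i = j then k else 0)" for k j
    by (induction k) auto
  have "count_list (concat (map (\<lambda>j. replicate (Poly_Mapping.lookup \<alpha> j) j) js)) i =
      (if i \<in> set js then Poly_Mapping.lookup \<alpha> i else 0)" if "distinct js" for js
    using that by (induction js) (auto simp: rep)
  then show ?thesis
    by (simp add: std_word_def in_keys_iff)
qed

lemma count_mset_std_word: "count (mset (letters (std_word \<alpha>))) i = Poly_Mapping.lookup \<alpha> i"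
  by (simp add: count_mset count_list_std_word)

lemma mset_std_word_add:
  "mset (letters (std_word (\<alpha> + \<beta>))) = mset (letters (std_word \<alpha> + std_word \<beta>))"
  by (rule multiset_eqI) (simp add: plus_fmonoid_def lookup_add count_mset_std_word)

lemma sorted_std_word: "sorted (letters (std_word \<alpha>))"
proof -
  have "sorted (concat (map (\<lambda>i. replicate (g i) i) js))" if "sorted js" for g :: "nat \<Rightarrow> nat" and js
    using that by (induction js) (auto simp: sorted_append)
  then show ?thesis
    by (simp add: std_word_def)
qed

lemma set_std_word: "set (letters (std_word \<alpha>)) = Poly_Mapping.keys \<alpha>"
  by (auto simp: std_word_def in_keys_iff)

text \<open>
  The embedding \<open>std\<close> is multiplicative on products of two monomials whose variables already come in
  the right order: the concatenated word is sorted, and a sorted word is determined by its letters.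
\<close>

lemma std_word_add:
  assumes "\<alpha> \<in> exponents {..<n}" "\<beta> \<in> exponents {n..}"
  shows "std_word (\<alpha> + \<beta>) = std_word \<alpha> + std_word \<beta>"
proof (rule fmonoid.expand)
  have "sorted (letters (std_word \<alpha> + std_word \<beta>))"
    using assms by (force simp: plus_fmonoid_def sorted_append sorted_std_word set_std_word exponents_def)
  then show "letters (std_word (\<alpha> + \<beta>)) = letters (std_word \<alpha> + std_word \<beta>)"
    using mset_std_word_add sorted_std_word by (metis properties_for_sort sort_key_id_if_sorted)
qed

definition expo_restrict :: "nat set \<Rightarrow> expo \<Rightarrow> expo" where
  "expo_restrict V \<alpha> = Poly_Mapping.mapp (\<lambda>i c. if i \<in> V then c else 0) \<alpha>"

lemma lookup_expo_restrict:
  "Poly_Mapping.lookup (expo_restrict V \<alpha>) i = (if i \<in> V then Poly_Mapping.lookup \<alpha> i else 0)"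
  by (auto simp: expo_restrict_def lookup_mapp when_def in_keys_iff)

lemma expo_restrict_exponents: "\<alpha> \<in> exponents W \<Longrightarrow> expo_restrict V \<alpha> \<in> exponents (V \<inter> W)"
  by (auto simp: exponents_def in_keys_iff lookup_expo_restrict split: if_splits)

lemma expo_restrict_compl: "expo_restrict V \<alpha> + expo_restrict (- V) \<alpha> = \<alpha>"
  by (rule poly_mapping_eqI) (auto simp: lookup_add lookup_expo_restrict)

lemma expo_restrict_add:
  assumes "\<alpha> \<in> exponents V" "\<beta> \<in> exponents (- V)"
  shows "expo_restrict V (\<alpha> + \<beta>) = \<alpha>" "expo_restrict (- V) (\<alpha> + \<beta>) = \<beta>"
  using assms by (auto simp: lookup_add lookup_expo_restrict exponents_def in_keys_iff subset_iff intro!: poly_mapping_eqI)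

section \<open>Expansion in powers of the \<open>y\<close> variables\<close>

text \<open>The coefficient \<open>p\<^sub>\<beta>\<close> of \<open>y\<^sup>\<beta>\<close>, where \<open>y\<close> stands for the variables outside \<open>V\<close>.\<close>

definition slice :: "nat set \<Rightarrow> 'k::field cpoly \<Rightarrow> expo \<Rightarrow> 'k cpoly" where
  "slice V p \<beta> = (\<Sum>\<alpha>\<in>{\<alpha>\<in>Poly_Mapping.keys p. expo_restrict (- V) \<alpha> = \<beta>}.
     Poly_Mapping.single (expo_restrict V \<alpha>) (Poly_Mapping.lookup p \<alpha>))"

lemma slice_closed: "slice V p \<beta> \<in> carrier (poly_ring V)"
proof -
  have "expo_restrict V \<alpha> \<in> exponents V" for \<alpha>
    using expo_restrict_exponents[of \<alpha> UNIV V] by (simp add: exponents_def)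
  then show ?thesis
    unfolding slice_def poly_ring_def by (auto dest!: subsetD[OF keys_sum] split: if_splits)
qed

lemma lookup_slice:
  assumes "\<alpha> \<in> exponents V" "\<beta> \<in> exponents (- V)"
  shows "Poly_Mapping.lookup (slice V p \<beta>) \<alpha> = Poly_Mapping.lookup p (\<alpha> + \<beta>)"
proof -
  have "Poly_Mapping.lookup (slice V p \<beta>) \<alpha> =
    (\<Sum>\<gamma>\<in>{\<gamma>\<in>Poly_Mapping.keys p. expo_restrict (- V) \<gamma> = \<beta>}. if \<gamma> = \<alpha> + \<beta> then Poly_Mapping.lookup p \<gamma> else 0)"
    unfolding slice_def lookup_sum
  proof (rule sum.cong)
    fix \<gamma> assume "\<gamma> \<in> {\<gamma>\<in>Poly_Mapping.keys p. expo_restrict (- V) \<gamma> = \<beta>}"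
    then have "expo_restrict V \<gamma> = \<alpha> \<longleftrightarrow> \<gamma> = \<alpha> + \<beta>"
      using expo_restrict_compl[of V \<gamma>] expo_restrict_add[OF assms] by auto
    then show "Poly_Mapping.lookup (Poly_Mapping.single (expo_restrict V \<gamma>) (Poly_Mapping.lookup p \<gamma>)) \<alpha> =
        (if \<gamma> = \<alpha> + \<beta> then Poly_Mapping.lookup p \<gamma> else 0)"
      by (simp add: lookup_single when_def)
  qed simp
  also have "\<dots> = Poly_Mapping.lookup p (\<alpha> + \<beta>)"
    by (auto simp: expo_restrict_add[OF assms] in_keys_iff)
  finally show ?thesis .
qed

lemma std_zero: "std 0 = 0"
  by (simp add: std_def)

lemma std_sum: "std (sum g A) = (\<Sum>a\<in>A. std (g a))"
  by (induction A rule: infinite_finite_induct) (simp_all add: std_zero std_add)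

lemma std_single: "std (Poly_Mapping.single \<alpha> c) = Poly_Mapping.single (std_word \<alpha>) c"
  by (simp add: std_def)

lemma std_expand_slices:
  fixes p :: "'k::field cpoly"
  shows "std p =
    (\<Sum>\<beta>\<in>expo_restrict (- {..<n}) ` Poly_Mapping.keys p. std (slice {..<n} p \<beta>) * mon (std_word \<beta>))"
proof -
  let ?V = "{..<n}" and ?K = "Poly_Mapping.keys p"
  have split: "Poly_Mapping.single (std_word \<alpha>) c =
      std (Poly_Mapping.single (expo_restrict ?V \<alpha>) c) * mon (std_word (expo_restrict (- ?V) \<alpha>))" for \<alpha> and c :: 'k
  proof -
    have "expo_restrict ?V \<alpha> \<in> exponents {..<n}" "expo_restrict (- ?V) \<alpha> \<in> exponents {n..}"
      using expo_restrict_exponents[of \<alpha> UNIV ?V] expo_restrict_exponents[of \<alpha> UNIV "- ?V"]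
      by (simp_all add: exponents_def)
    then have "std_word \<alpha> = std_word (expo_restrict ?V \<alpha>) + std_word (expo_restrict (- ?V) \<alpha>)"
      using std_word_add expo_restrict_compl by metis
    then show ?thesis
      by (simp add: std_single mon_def mult_single)
  qed
  have "std p = (\<Sum>\<alpha>\<in>?K. std (Poly_Mapping.single (expo_restrict ?V \<alpha>) (Poly_Mapping.lookup p \<alpha>))
      * mon (std_word (expo_restrict (- ?V) \<alpha>)))"
    unfolding std_def[of p] by (rule sum.cong[OF refl split])
  also have "\<dots> = (\<Sum>\<beta>\<in>expo_restrict (- ?V) ` ?K. \<Sum>\<alpha>\<in>{\<alpha>\<in>?K. expo_restrict (- ?V) \<alpha> = \<beta>}.
      std (Poly_Mapping.single (expo_restrict ?V \<alpha>) (Poly_Mapping.lookup p \<alpha>)) * mon (std_word (expo_restrict (- ?V) \<alpha>)))"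
    by (rule sum.image_gen) simp
  also have "\<dots> = (\<Sum>\<beta>\<in>expo_restrict (- ?V) ` ?K. std (slice ?V p \<beta>) * mon (std_word \<beta>))"
    by (rule sum.cong) (simp_all add: slice_def std_sum sum_distrib_right)
  finally show ?thesis .
qed

text \<open>
  Multiplication by \<open>y\<^sup>\<beta>\<close> is strictly monotone, so a monomial of the slice through the leading
  monomial \<open>x\<^sup>\<alpha> y\<^sup>\<beta>\<close> of \<open>p\<close> that exceeded \<open>x\<^sup>\<alpha>\<close> would give a monomial of \<open>p\<close> above the leading one.
\<close>

lemma le_slice:
  fixes p :: "'k::field cpoly"
  assumes ord: "monomial_ordering W lt" and "V \<subseteq> W" and p: "Poly_Mapping.keys p \<subseteq> exponents W"
    and "p \<noteq> 0"
  defines "\<beta> \<equiv> expo_restrict (- V) (le lt p)"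
  shows "slice V p \<beta> \<noteq> 0" and "le lt (slice V p \<beta>) = expo_restrict V (le lt p)"
proof -
  let ?\<mu> = "le lt p" and ?s = "slice V p \<beta>"
  note max = le_max[OF ord p \<open>p \<noteq> 0\<close>]
  have VW: "exponents V \<subseteq> exponents W"
    by (rule exponents_mono[OF \<open>V \<subseteq> W\<close>])
  have a: "expo_restrict V ?\<mu> \<in> exponents V" and b: "\<beta> \<in> exponents (- V)"
    using expo_restrict_exponents[of ?\<mu> UNIV] by (simp_all add: exponents_def \<beta>_def)
  have bW: "\<beta> \<in> exponents W"
    using expo_restrict_exponents[of ?\<mu> W "- V"] max(1) p by (auto simp: exponents_def \<beta>_def)
  have lk: "Poly_Mapping.lookup ?s \<alpha> = Poly_Mapping.lookup p (\<alpha> + \<beta>)" if "\<alpha> \<in> exponents V" for \<alpha>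
    by (rule lookup_slice[OF that b])
  have mu: "expo_restrict V ?\<mu> + \<beta> = ?\<mu>"
    by (simp add: \<beta>_def expo_restrict_compl)
  have sV: "Poly_Mapping.keys ?s \<subseteq> exponents V"
    using slice_closed[of V p \<beta>] by (simp add: poly_ring_def)
  have akey: "expo_restrict V ?\<mu> \<in> Poly_Mapping.keys ?s"
    using max(1) by (simp add: in_keys_iff lk[OF a] mu)
  then show "?s \<noteq> 0"
    by auto
  show "le lt ?s = expo_restrict V ?\<mu>"
  proof (rule le_eqI[OF ord _ akey])
    show "Poly_Mapping.keys ?s \<subseteq> exponents W"
      using sV VW by blast
    fix \<alpha> assume "\<alpha> \<in> Poly_Mapping.keys ?s"
    with sV have \<alpha>: "\<alpha> \<in> exponents V" and key: "\<alpha> + \<beta> \<in> Poly_Mapping.keys p"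
      by (auto simp: in_keys_iff lk subset_iff)
    show "\<alpha> = expo_restrict V ?\<mu> \<or> lt \<alpha> (expo_restrict V ?\<mu>)"
    proof (rule ccontr)
      assume "\<not> (\<alpha> = expo_restrict V ?\<mu> \<or> lt \<alpha> (expo_restrict V ?\<mu>))"
      then have "lt (expo_restrict V ?\<mu>) \<alpha>"
        using totalp_onD[OF monomial_orderingD(3)[OF ord] subsetD[OF VW \<alpha>] subsetD[OF VW a]] by blast
      then have up: "lt ?\<mu> (\<alpha> + \<beta>)"
        using monomial_orderingD(4)[OF ord, of "expo_restrict V ?\<mu>" \<alpha> \<beta>] \<alpha> a VW bW mu by auto
      have "\<alpha> + \<beta> = ?\<mu> \<or> lt (\<alpha> + \<beta>) ?\<mu>"
        by (rule max(2)[OF key])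
      then have "lt ?\<mu> ?\<mu>"
        using up monomial_orderingD(2)[OF ord] max(1) p key by (metis subsetD transp_onD)
      then show False
        using monomial_orderingD(1)[OF ord] max(1) p by (meson irreflp_onD subsetD)
    qed
  qed
qed

section \<open>Commuting variables modulo an ideal\<close>

lemma scalar_closed: "scalar c \<in> carrier (free_alg V)"
  by (simp add: free_alg_def words_def scalar_def zero_fmonoid_def)

lemma mon_plus: "mon (u + v) = mon u * mon v"
  by (simp add: mon_def mult_single)

text \<open>
  For elements \<open>a, b\<close> of the free algebra, congruence modulo \<open>J\<close> is written \<open>a - b \<in> J\<close> with the
  arithmetic of the ambient type, so the closure properties of \<open>J\<close> are first put in that form.
\<close>

context
  fixes V :: "nat set" and J :: "'k::field ncpoly set"
  assumes J: "ideal J (free_alg V)"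
begin

lemma ideal_zero: "0 \<in> J"
  using additive_subgroup.zero_closed[OF ideal.axioms(1)[OF J]] by (simp add: free_alg_def)

lemma ideal_add: "a \<in> J \<Longrightarrow> b \<in> J \<Longrightarrow> a + b \<in> J"
  using additive_subgroup.a_closed[OF ideal.axioms(1)[OF J]] by (simp add: free_alg_def)

lemma ideal_mult_left: "a \<in> J \<Longrightarrow> q \<in> carrier (free_alg V) \<Longrightarrow> q * a \<in> J"
  using ideal.I_l_closed[OF J] by (simp add: free_alg_def)

lemma ideal_mult_right: "a \<in> J \<Longrightarrow> q \<in> carrier (free_alg V) \<Longrightarrow> a * q \<in> J"
  using ideal.I_r_closed[OF J] by (simp add: free_alg_def)

lemma ideal_uminus: "a \<in> J \<Longrightarrow> - a \<in> J"
  using ideal_mult_left[OF _ scalar_closed[of "- 1"]] by (simp add: scalar_def single_uminus)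

lemma ideal_sum: "(\<And>x. x \<in> A \<Longrightarrow> g x \<in> J) \<Longrightarrow> sum g A \<in> J"
  by (induction A rule: infinite_finite_induct) (simp_all add: ideal_zero ideal_add)

text \<open>
  Two arrangements of the same letters are linked by exchanges of neighbours, and each exchange
  changes the word by a multiple of a commutator. The exchanges are organised as an insertion sort:
  the first letter of \<open>u\<close> is moved to the front of \<open>v\<close>, and the remaining letters follow by
  induction.
\<close>

lemma permuted_words_congruent:
  assumes UV: "U \<subseteq> V" and comm: "\<And>i j. i \<in> U \<Longrightarrow> j \<in> U \<Longrightarrow> commutator (Z j) (Z i) \<in> J"
    and perm: "mset (letters u) = mset (letters v)" and u: "set (letters u) \<subseteq> U"
  shows "mon u - mon v \<in> J"
proof -
  have Wapp: "Word (xs @ ys) = Word xs + Word ys" for xs ys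
    by (simp add: plus_fmonoid_def)
  have closed: "mon (Word xs) \<in> carrier (free_alg V)" if "set xs \<subseteq> U" for xs
    using that UV by (intro mon_closed) (auto simp: words_def)
  have move: "mon (Word (x # xs)) - mon (Word (xs @ [x])) \<in> J" if "x \<in> U" "set xs \<subseteq> U" for x xs
    using that(2)
  proof (induction xs)
    case Nil
    then show ?case by (simp add: ideal_zero)
  next
    case (Cons y xs)
    \<comment> \<open>\<open>x y xs - y xs x = [x, y] xs + y (x xs - xs x)\<close> in words\<close>
    have "commutator (Z x) (Z y) * mon (Word xs) \<in> J"
      using Cons.prems \<open>x \<in> U\<close> by (intro ideal_mult_right comm closed) auto
    moreover have "mon (Word [y]) * (mon (Word (x # xs)) - mon (Word (xs @ [x]))) \<in> J"
      using Cons by (intro ideal_mult_left closed) auto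
    moreover have "mon (Word (x # y # xs)) - mon (Word ((y # xs) @ [x])) =
        commutator (Z x) (Z y) * mon (Word xs) +
        mon (Word [y]) * (mon (Word (x # xs)) - mon (Word (xs @ [x])))"
      by (simp add: commutator_def Z_def algebra_simps plus_fmonoid_def flip: mon_plus)
    ultimately show ?case
      using ideal_add by metis
  qed
  have "mon (Word xs) - mon (Word ys) \<in> J" if "mset xs = mset ys" "set xs \<subseteq> U" for xs ys
    using that
  proof (induction xs arbitrary: ys)
    case Nil
    then show ?case by (simp add: ideal_zero)
  next
    case (Cons x xs)
    have "x \<in> set ys"
      using Cons.prems(1) by (metis list.set_intros(1) set_mset_mset)
    then obtain as bs where ys: "ys = as @ x # bs"
      by (meson split_list)
    have sub: "set as \<subseteq> U" "set bs \<subseteq> U"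
      using Cons.prems ys by (metis mset_eq_setD order_trans set_append Un_upper1 Un_upper2 set_subset_Cons)+
    \<comment> \<open>\<open>x xs - as x bs = x (xs - as bs) + (x as - as x) bs\<close> in words\<close>
    have "mon (Word [x]) * (mon (Word xs) - mon (Word (as @ bs))) \<in> J"
      using Cons.prems ys by (intro ideal_mult_left closed Cons.IH) auto
    moreover have "(mon (Word (x # as)) - mon (Word (as @ [x]))) * mon (Word bs) \<in> J"
      using sub Cons.prems by (intro ideal_mult_right closed move) auto
    moreover have "mon (Word (x # xs)) - mon (Word ys) =
        mon (Word [x]) * (mon (Word xs) - mon (Word (as @ bs))) +
        (mon (Word (x # as)) - mon (Word (as @ [x]))) * mon (Word bs)"
      by (simp add: ys algebra_simps plus_fmonoid_def flip: mon_plus)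
    ultimately show ?case
      using ideal_add by metis
  qed
  from this[OF perm u] show ?thesis
    by simp
qed

text \<open>
  Only the \<open>x\<close> part of the monomial has to be merged into the words of \<open>g\<close>; its \<open>y\<close> part stays at
  the right end. Therefore \<open>std (g z\<^sup>\<gamma>)\<close> and \<open>std g \<cdot> z\<^sup>\<gamma>\<close> agree modulo the commutators of the \<open>x\<close>
  variables alone.
\<close>

lemma std_times_monomial_in_ideal:
  fixes g :: "'k cpoly"
  assumes V: "{..<n} \<subseteq> V" and comm: "\<And>i j. i < n \<Longrightarrow> j < n \<Longrightarrow> commutator (Z j) (Z i) \<in> J"
    and g: "g \<in> carrier (poly_ring {..<n})" "std g \<in> J" and \<gamma>: "\<gamma> \<in> exponents V"
  shows "std (g * Poly_Mapping.single \<gamma> 1) \<in> J"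
proof -
  let ?x = "expo_restrict {..<n} \<gamma>" and ?y = "expo_restrict (- {..<n}) \<gamma>" and ?K = "Poly_Mapping.keys g"
  have x: "?x \<in> exponents {..<n}" and y: "?y \<in> exponents {n..}" and yV: "?y \<in> exponents V"
    using expo_restrict_exponents[of \<gamma> UNIV] expo_restrict_exponents[OF \<gamma>, of "- {..<n}"]
    by (auto simp: exponents_def)
  have \<gamma>word: "std_word \<gamma> = std_word ?x + std_word ?y"
    using std_word_add[OF x y] expo_restrict_compl[of "{..<n}" \<gamma>] by metis
  have diff: "std (g * Poly_Mapping.single \<gamma> 1) - std g * mon (std_word \<gamma>) =
      (\<Sum>\<alpha>\<in>?K. scalar (Poly_Mapping.lookup g \<alpha>) *
         (mon (std_word (\<alpha> + ?x)) - mon (std_word \<alpha> + std_word ?x)) * mon (std_word ?y))"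
  proof -
    have "std_word (\<alpha> + \<gamma>) = std_word (\<alpha> + ?x) + std_word ?y" if "\<alpha> \<in> ?K" for \<alpha>
    proof -
      have "\<alpha> + ?x \<in> exponents {..<n}"
        using that g(1) x by (auto simp: poly_ring_def intro: exponents_add)
      then show ?thesis
        using std_word_add[OF _ y] expo_restrict_compl[of "{..<n}" \<gamma>] by (metis add.assoc)
    qed
    moreover have "std g * mon (std_word \<gamma>) =
        (\<Sum>\<alpha>\<in>?K. Poly_Mapping.single (std_word \<alpha> + std_word \<gamma>) (Poly_Mapping.lookup g \<alpha>))"
      by (simp add: std_def mon_def sum_distrib_right mult_single)
    ultimately show ?thesis
      by (simp add: times_monomial std_sum std_single \<gamma>word scalar_def mon_def mult_single
          algebra_simps flip: sum_subtractf)
  qed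
  have "scalar (Poly_Mapping.lookup g \<alpha>) * (mon (std_word (\<alpha> + ?x)) - mon (std_word \<alpha> + std_word ?x))
      * mon (std_word ?y) \<in> J" if "\<alpha> \<in> ?K" for \<alpha>
  proof -
    have "\<alpha> + ?x \<in> exponents {..<n}"
      using that g(1) x by (auto simp: poly_ring_def intro: exponents_add)
    then have "set (letters (std_word (\<alpha> + ?x))) \<subseteq> {..<n}"
      by (simp add: set_std_word exponents_def)
    then have "mon (std_word (\<alpha> + ?x)) - mon (std_word \<alpha> + std_word ?x) \<in> J"
      using V comm mset_std_word_add by (intro permuted_words_congruent[where U = "{..<n}"]) auto
    then show ?thesis
      by (intro ideal_mult_right[OF ideal_mult_left] scalar_closed mon_closed std_word_closed yV)
  qed
  then have "std (g * Poly_Mapping.single \<gamma> 1) - std g * mon (std_word \<gamma>) \<in> J"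
    unfolding diff by (rule ideal_sum)
  moreover have "std g * mon (std_word \<gamma>) \<in> J"
    using g(2) \<gamma> by (intro ideal_mult_right mon_closed std_word_closed)
  ultimately show ?thesis
    using ideal_add by fastforce
qed

end

section \<open>Elements killed by an injective \<open>\<psi>\<close>\<close>

lemma finsum_cosets:
  fixes R :: "'k::field ncpoly set"
  assumes R: "ideal R (free_alg V)" and "finite B"
    and g: "\<And>\<beta>. \<beta> \<in> B \<Longrightarrow> g \<beta> \<in> carrier (free_alg V)"
  shows "finsum (free_alg V Quot R) (\<lambda>\<beta>. R +>\<^bsub>free_alg V\<^esub> g \<beta>) B = R +>\<^bsub>free_alg V\<^esub> (\<Sum>\<beta>\<in>B. g \<beta>)"
proof -
  interpret R: ideal R "free_alg V :: 'k ncpoly ring" by (rule R)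
  interpret Q: ring "free_alg V Quot R" by (rule R.quotient_is_ring)
  have "(\<Sum>\<beta>\<in>B. g \<beta>) \<in> carrier (free_alg V) \<and> ?thesis"
    using assms(2,3)
  proof (induction B rule: finite_induct)
    case empty
    have "0 \<in> carrier (free_alg V :: 'k ncpoly ring)"
      by (simp add: free_alg_def)
    then show ?case
      unfolding Q.finsum_empty by (simp add: FactRing_def a_r_coset_def r_coset_def free_alg_def)
  next
    case (insert b B)
    then have b: "g b \<in> carrier (free_alg V)" and s: "(\<Sum>\<beta>\<in>B. g \<beta>) \<in> carrier (free_alg V)"
      and IH: "finsum (free_alg V Quot R) (\<lambda>\<beta>. R +>\<^bsub>free_alg V\<^esub> g \<beta>) B = R +>\<^bsub>free_alg V\<^esub> (\<Sum>\<beta>\<in>B. g \<beta>)"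
      by auto
    have "finsum (free_alg V Quot R) (\<lambda>\<beta>. R +>\<^bsub>free_alg V\<^esub> g \<beta>) (insert b B) =
        (R +>\<^bsub>free_alg V\<^esub> g b) \<oplus>\<^bsub>free_alg V Quot R\<^esub> (R +>\<^bsub>free_alg V\<^esub> (\<Sum>\<beta>\<in>B. g \<beta>))"
      using insert.hyps insert.prems
      by (subst Q.finsum_insert) (auto simp: IH intro!: coset_in_quot[OF R])
    also have "\<dots> = R +>\<^bsub>free_alg V\<^esub> (g b + (\<Sum>\<beta>\<in>B. g \<beta>))"
      using R.a_rcos_sum[OF b s] by (simp add: FactRing_def add_free_alg)
    finally show ?case
      using insert.hyps R.a_closed[OF b s] by (simp add: add_free_alg)
  qed
  then show ?thesis ..
qed

text \<open>
  The classes of the slices of \<open>p\<close> form an element \<open>F\<close> of the direct sum that \<open>\<psi>\<close> sends to the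
  class of \<open>std p\<close>. This class is zero, hence \<open>F = 0\<close> by injectivity.
\<close>

lemma slice_in_ideal_if_inj_psi:
  fixes I :: "'k::field cpoly set"
  assumes I: "ideal I (poly_ring {..<n})" and S: "S \<subseteq> carrier (free_alg {..<n + m})"
    and inj: "inj_on (psi n m I S) (carrier (psi_domain n m I))"
    and p: "p \<in> carrier (poly_ring {..<n + m})" and std_p: "std p \<in> rel_ideal n m I S"
    and \<beta>: "\<beta> \<in> expo_restrict (- {..<n}) ` Poly_Mapping.keys p"
  shows "slice {..<n} p \<beta> \<in> I"
proof -
  let ?A = "free_alg {..<n + m} :: 'k ncpoly ring" and ?P = "poly_ring {..<n} :: 'k cpoly ring"
  let ?R = "rel_ideal n m I S" and ?Y = "exponents {n..<n + m}"
  define B where "B = expo_restrict (- {..<n}) ` Poly_Mapping.keys p"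
  interpret I: ideal I ?P by (rule I)
  interpret R: ideal ?R ?A by (rule rel_ideal_ideal[OF I S])
  interpret QP: ring "?P Quot I" by (rule I.quotient_is_ring)
  have "finite B"
    by (simp add: B_def)
  have eq: "- {..<n} \<inter> {..<n + m} = {n..<n + m}"
    by auto
  have BY: "B \<subseteq> ?Y"
    using p expo_restrict_exponents[of _ "{..<n + m}" "- {..<n}"] unfolding eq
    by (auto simp: B_def poly_ring_def)
  define F where "F = (\<lambda>\<beta>\<in>?Y. if \<beta> \<in> B then I +>\<^bsub>?P\<^esub> slice {..<n} p \<beta> else \<zero>\<^bsub>?P Quot I\<^esub>)"
  define G where "G = (\<lambda>\<beta>\<in>?Y. \<zero>\<^bsub>?P Quot I\<^esub>)"
  have "finite {\<beta> \<in> ?Y. F \<beta> \<noteq> \<zero>\<^bsub>?P Quot I\<^esub>}"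
    by (rule finite_subset[OF _ \<open>finite B\<close>]) (auto simp: F_def)
  then have F: "F \<in> carrier (psi_domain n m I)"
    by (auto simp: psi_domain_carrier[OF I S] F_def intro!: coset_in_quot[OF I] slice_closed)
  have G: "G \<in> carrier (psi_domain n m I)"
    by (auto simp: psi_domain_carrier[OF I S] G_def)
  have "psi n m I S F = finsum (?A Quot ?R) (\<lambda>\<beta>. psi_term n m I S \<beta> (F \<beta>)) B"
    by (rule psi_superset[OF I S F \<open>finite B\<close> BY]) (simp add: F_def)
  also have "\<dots> = finsum (?A Quot ?R)
      (\<lambda>\<beta>. ?R +>\<^bsub>?A\<^esub> (std (slice {..<n} p \<beta>) * mon (std_word \<beta>))) B"
  proof -
    interpret Q: ring "?A Quot ?R" by (rule ring_quot[OF I S])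
    show ?thesis
      using BY
      by (intro Q.finsum_cong')
        (auto simp: F_def psi_term_coset[OF I S slice_closed] subset_iff
          intro!: coset_in_quot[OF rel_ideal_ideal[OF I S]] prod_mon_closed[OF I S slice_closed])
  qed
  also have "\<dots> = ?R +>\<^bsub>?A\<^esub> std p"
    using BY std_expand_slices[of p n]
    by (subst finsum_cosets[OF rel_ideal_ideal[OF I S] \<open>finite B\<close>])
      (auto simp: B_def intro!: prod_mon_closed[OF I S slice_closed])
  also have "\<dots> = ?R"
    by (rule R.a_rcos_const[OF std_p])
  also have "\<dots> = psi n m I S G"
    by (subst psi_superset[OF I S G, of "{}"])
      (simp_all add: G_def abelian_monoid.finsum_empty[OF
        abelian_group.axioms(1)[OF ring.is_abelian_group[OF R.quotient_is_ring]]],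
       simp add: FactRing_def)
  finally have "F = G"
    using inj F G by (meson inj_onD)
  then have "F \<beta> = G \<beta>"
    by simp
  with \<beta> BY have "I +>\<^bsub>?P\<^esub> slice {..<n} p \<beta> = I"
    by (auto simp: F_def G_def B_def FactRing_def)
  then show ?thesis
    using I.rcos_const_imp_mem[OF slice_closed] by simp
qed

section \<open>The PBW-reduction datum\<close>

theorem lemma1p14:
  fixes n m :: nat
    and I I' :: "'k::field cpoly set"
    and S :: "'k ncpoly set"
    and lt :: "expo \<Rightarrow> expo \<Rightarrow> bool"
    and d f :: "nat \<Rightarrow> nat \<Rightarrow> 'k cpoly"
  assumes I: "ideal I (poly_ring {..<n})"
    and S_comm: "commutation_system (n + m) S lt"
    and well: "well_ordering {..<n + m} lt"
    and d: "\<And>k l. k < l \<Longrightarrow> l < m \<Longrightarrow> d k l \<in> carrier (poly_ring {..<n})"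
    and f: "\<And>i k. i < n \<Longrightarrow> k < m \<Longrightarrow> f i k \<in> carrier (poly_ring {..<n})"
    and S: "S = {commutator (Z j) (Z i) | i j. i < j \<and> j < n}
              \<union> {commutator (Z (n + l)) (Z (n + k)) - std (d k l) | k l. k < l \<and> l < m}
              \<union> {commutator (Z (n + k)) (Z i) - std (f i k) | i k. i < n \<and> k < m}"
    and inj: "inj_on (psi n m I S) (carrier (psi_domain n m I))"
    and gb: "groebner_basis {..<n} lt I' I"
  shows "PBW_reduction_datum (n + m) S I' lt"
proof -
  let ?A = "free_alg {..<n + m} :: 'k ncpoly ring"
  let ?N = "{..<n + m}"
  define J where "J = genideal ?A (std ` I' \<union> S)"
  have ord: "monomial_ordering ?N lt"
    using S_comm by (simp add: commutation_system_def)
  have "finite I'" and I'I: "I' \<subseteq> I" and L: "Lset {..<n} lt I' = Lset {..<n} lt I"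
    using gb by (auto simp: groebner_basis_def)
  have IP: "I \<subseteq> carrier (poly_ring {..<n})"
    using I by (auto dest!: ideal.axioms(1) additive_subgroup.a_subset)
  have nN: "exponents {..<n} \<subseteq> exponents ?N"
    by (rule exponents_mono) auto
  have PN: "carrier (poly_ring {..<n} :: 'k cpoly ring) \<subseteq> carrier (poly_ring ?N)"
    by (rule poly_ring_mono) auto
  have S_closed: "S \<subseteq> carrier ?A"
  proof -
    interpret A: ring ?A by (rule ring_free_alg)
    have minus: "a - b \<in> carrier ?A" if "a \<in> carrier ?A" "b \<in> carrier ?A" for a b
      using that keys_diff[of a b] by (auto simp: free_alg_def)
    have Zc: "Z i \<in> carrier ?A" if "i < n + m" for i
      unfolding Z_def using that by (intro mon_closed) (simp add: words_def)
    have "commutator (Z j) (Z i) \<in> carrier ?A" if "i < n + m" "j < n + m" for i j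
      unfolding commutator_def
      using A.m_closed[OF Zc Zc] that by (intro minus) (simp_all add: mult_free_alg)
    then show ?thesis
      unfolding S using d f PN by (auto intro!: minus std_closed)
  qed
  have gens: "std ` I' \<union> S \<subseteq> carrier ?A"
    using S_closed I'I IP PN std_closed by blast
  have J: "ideal J ?A"
    unfolding J_def by (rule ring.genideal_ideal[OF ring_free_alg gens])
  have gensJ: "std ` I' \<union> S \<subseteq> J"
    unfolding J_def by (rule ring.genideal_self[OF ring_free_alg gens])
  have JR: "J \<subseteq> rel_ideal n m I S"
  proof -
    interpret R: ideal "rel_ideal n m I S" ?A
      by (rule rel_ideal_ideal[OF I S_closed])
    have "std ` I \<union> S \<subseteq> rel_ideal n m I S"
      by (auto simp: genideal_def)
    then show ?thesis
      unfolding J_def using I'I by (intro R.genideal_minimal[OF R.is_ideal]) blast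
  qed
  \<comment> \<open>\<open>S\<close> lists the commutators for \<open>i < j\<close> only; the others follow by antisymmetry\<close>
  have comm: "commutator (Z j) (Z i) \<in> J" if "i < n" "j < n" for i j
  proof -
    have less: "commutator (Z j) (Z i) \<in> J" if "i < j" "j < n" for i j
      using that gensJ S by blast
    have anti: "commutator (Z j) (Z i) = - (commutator (Z i) (Z j) :: 'k ncpoly)"
      by (simp add: commutator_def)
    show ?thesis
    proof (cases i j rule: linorder_cases)
      case equal
      then show ?thesis
        using ideal_zero[OF J] by (simp add: commutator_def)
    next
      case greater
      then show ?thesis
        unfolding anti using less \<open>i < n\<close> by (intro ideal_uminus[OF J])
    qed (use less \<open>j < n\<close> in blast)
  qed
  have "Lset ?N lt I' = lset lt {p \<in> carrier (poly_ring ?N). std p \<in> J}"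
  proof (intro subset_antisym subsetI)
    fix \<delta> assume "\<delta> \<in> Lset ?N lt I'"
    then obtain g \<gamma> where g: "g \<in> I'" "g \<noteq> 0" and \<gamma>: "\<gamma> \<in> exponents ?N" and \<delta>: "\<delta> = le lt g + \<gamma>"
      by (auto simp: Lset_def lset_def)
    let ?p = "g * Poly_Mapping.single \<gamma> 1"
    have gP: "g \<in> carrier (poly_ring {..<n})"
      using g(1) I'I IP by blast
    then have gN: "Poly_Mapping.keys g \<subseteq> exponents ?N"
      using nN by (auto simp: poly_ring_def)
    have "std ?p \<in> J"
      using std_times_monomial_in_ideal[OF J _ comm gP _ \<gamma>] g(1) gensJ by auto
    moreover have "?p \<in> carrier (poly_ring ?N)"
      using gN \<gamma> by (auto simp: poly_ring_def keys_times_monomial intro: exponents_add)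
    moreover have "?p \<noteq> 0"
      using g(2) keys_times_monomial[of g \<gamma>] by (metis image_is_empty keys_eq_empty)
    ultimately show "\<delta> \<in> lset lt {p \<in> carrier (poly_ring ?N). std p \<in> J}"
      unfolding lset_def \<delta> using le_times_monomial[OF ord gN g(2) \<gamma>] by force
  next
    fix \<delta> assume "\<delta> \<in> lset lt {p \<in> carrier (poly_ring ?N). std p \<in> J}"
    then obtain p where p: "p \<in> carrier (poly_ring ?N)" "std p \<in> J" "p \<noteq> 0" and \<delta>: "\<delta> = le lt p"
      by (auto simp: lset_def)
    have pN: "Poly_Mapping.keys p \<subseteq> exponents ?N"
      using p(1) by (simp add: poly_ring_def)
    define \<beta> where "\<beta> = expo_restrict (- {..<n}) \<delta>"
    have \<delta>key: "\<delta> \<in> Poly_Mapping.keys p"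
      using le_max(1)[OF ord pN p(3)] \<delta> by simp
    have "slice {..<n} p \<beta> \<in> I"
      using slice_in_ideal_if_inj_psi[OF I S_closed inj p(1)] p(2) JR \<delta>key by (auto simp: \<beta>_def)
    moreover have "slice {..<n} p \<beta> \<noteq> 0" "le lt (slice {..<n} p \<beta>) = expo_restrict {..<n} \<delta>"
      using le_slice[OF ord _ pN p(3), of "{..<n}"] by (auto simp: \<beta>_def \<delta>)
    ultimately have "expo_restrict {..<n} \<delta> \<in> lset lt I"
      unfolding lset_def by force
    then have "expo_restrict {..<n} \<delta> + 0 \<in> Lset {..<n} lt I"
      unfolding Lset_def by (force simp: exponents_def)
    then obtain \<alpha> \<gamma> where \<alpha>: "\<alpha> \<in> lset lt I'" and \<gamma>: "\<gamma> \<in> exponents {..<n}" and "expo_restrict {..<n} \<delta> = \<alpha> + \<gamma>"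
      unfolding L[symmetric] by (auto simp: Lset_def)
    then have "\<delta> = \<alpha> + (\<gamma> + \<beta>)"
      using expo_restrict_compl[of "{..<n}" \<delta>] by (simp add: \<beta>_def add.assoc)
    moreover have "\<gamma> + \<beta> \<in> exponents ?N"
      using \<gamma> nN expo_restrict_exponents[of \<delta> ?N "- {..<n}"] pN \<delta>key
      by (intro exponents_add) (auto simp: \<beta>_def exponents_def)
    ultimately show "\<delta> \<in> Lset ?N lt I'"
      using \<alpha> by (auto simp: Lset_def)
  qed
  then show ?thesis
    unfolding PBW_reduction_datum_def J_def[symmetric]
    using S_comm well \<open>finite I'\<close> I'I IP PN by auto
qed

end
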